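(* Let $I=[0,1]$ and let $\phi:I\to\mathbb{R}$ satisfy $\phi(0)=\phi(1)=0$ and $|\phi(x)-\phi(y)|\le|x-y|$ for all $x,y\in I$. For $\theta\in[-1,1]$ let $C_\theta(u,v)=uv+\theta\,\phi(u)\phi(v)$ on $I^2$. (i) The family $\{C_\theta\}_{\theta\in[-1,1]}$ is ordered in concordance if and only if $\phi$ is either positive or negative (that is, either $\phi(u)\ge 0$ for all $u\in I$ or $\phi(u)\le0$ for all $u\in I$). (ii) Assume $\phi$ is twice differentiable. Then $\{C_\theta\}_{\theta\in[-1,1]}$ is SI ordered if $\phi$ is either convex or concave.
   Context: Under the stated conditions on $\phi$, each $C_\theta$ is a bivariate copula (a bivariate distribution function on $I^2$ with uniform margins). Let $H$ and $H^*$ be two bivariate cumulative distribution functions with the same margins. Concordance order: $H\prec_C H^*$ if $H(x_1,x_2)\le H^*(x_1,x_2)$ for all $(x_1,x_2)$. SI order: let $H_{2|1}(\cdot|x_1)$ and $H^*_{2|1}(\cdot|x_1)$ be the conditional distribution functions of the second random variable given that the first equals $x_1$; then $H\prec_{SI}H^*$ if ${H^*_{2|1}}^{-1}\big(H_{2|1}(x_2|x_1)\,\big|\,x_1\big)$ is increasing in $x_1$, where ${H^*_{2|1}}^{-1}(\cdot|x_1)$ denotes the inverse of $H^*_{2|1}(\cdot|x_1)$ for fixed $x_1$. The family $\{C_\theta\}$ is ordered in concordance if $\theta\le\theta'$ implies $C_\theta\prec_C C_{\theta'}$; it is SI ordered if $\theta\le\theta'$ implies $C_\theta\prec_{SI}C_{\theta'}$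 (with $\theta,\theta'\in[-1,1]$). *)

theory Defs
  imports "HOL-Probability.Probability"
begin

definition bivariate_cdf :: "(real \<Rightarrow> real \<Rightarrow> real) \<Rightarrow> bool" where
  "bivariate_cdf H \<longleftrightarrow>
     (\<forall>x x' y y'. x \<le> x' \<longrightarrow> y \<le> y' \<longrightarrow> 0 \<le> H x' y' - H x' y - H x y' + H x y) \<and>
     (\<forall>x y. ((\<lambda>(s, t). H s t) \<longlongrightarrow> H x y) (at (x, y) within {x..} \<times> {y..})) \<and>
     (\<forall>y. ((\<lambda>x. H x y) \<longlongrightarrow> 0) at_bot) \<and>
     (\<forall>x. ((\<lambda>y. H x y) \<longlongrightarrow> 0) at_bot) \<and>
     ((\<lambda>(x, y). H x y) \<longlongrightarrow> 1) (at_top \<times>\<^sub>F at_top)"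

definition margin1 :: "(real \<Rightarrow> real \<Rightarrow> real) \<Rightarrow> real \<Rightarrow> real" where
  "margin1 H x = Lim at_top (\<lambda>y. H x y)"

definition margin2 :: "(real \<Rightarrow> real \<Rightarrow> real) \<Rightarrow> real \<Rightarrow> real" where
  "margin2 H y = Lim at_top (\<lambda>x. H x y)"

definition same_margins :: "(real \<Rightarrow> real \<Rightarrow> real) \<Rightarrow> (real \<Rightarrow> real \<Rightarrow> real) \<Rightarrow> bool" where
  "same_margins H H' \<longleftrightarrow> margin1 H = margin1 H' \<and> margin2 H = margin2 H'"

definition concordance_le :: "(real \<Rightarrow> real \<Rightarrow> real) \<Rightarrow> (real \<Rightarrow> real \<Rightarrow> real) \<Rightarrow> bool" where
  "concordance_le H H' \<longleftrightarrow>
     bivariate_cdf H \<and> bivariate_cdf H' \<and> same_margins H H' \<and>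
     (\<forall>x1 x2. H x1 x2 \<le> H' x1 x2)"

text \<open>\<open>conditional_cdf H K\<close>: the function \<open>K x1\<close> is a version of the distribution function of
  the second variable given that the first one equals \<open>x1\<close>, when the pair has joint distribution
  function \<open>H\<close>. It is determined only up to a null set of the law \<open>\<mu>\<close> of the first variable.\<close>

definition conditional_cdf ::
    "(real \<Rightarrow> real \<Rightarrow> real) \<Rightarrow> (real \<Rightarrow> real \<Rightarrow> real) \<Rightarrow> bool" where
  "conditional_cdf H K \<longleftrightarrow>
     (\<forall>x1. \<exists>\<nu>. real_distribution \<nu> \<and> K x1 = cdf \<nu>) \<and>
     (\<forall>x2. (\<lambda>x1. K x1 x2) \<in> borel_measurable borel) \<and>
     (\<exists>\<mu>. real_distribution \<mu> \<and> cdf \<mu> = margin1 H \<and>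
        (\<forall>x1 x2. H x1 x2 = (LINT s:{..x1}|\<mu>. K s x2)))"

text \<open>\<open>is_inverse F J\<close>: at each level \<open>t\<close> the value \<open>J t\<close> is a point where \<open>F\<close> crosses \<open>t\<close>. If \<open>F\<close>
  is continuous and takes the value \<open>t\<close> exactly once, then \<open>J t\<close> is the point where it does; in
  general, both the left-continuous and the right-continuous quantile functions qualify. Extended
  reals are needed for the levels 0 and 1.\<close>

definition is_inverse :: "(real \<Rightarrow> real) \<Rightarrow> (real \<Rightarrow> ereal) \<Rightarrow> bool" where
  "is_inverse F J \<longleftrightarrow>
     (\<forall>t\<in>{0..1}. \<forall>z. (ereal z < J t \<longrightarrow> F z \<le> t) \<and> (J t < ereal z \<longrightarrow> t \<le> F z))"

text \<open>Versions \<open>K\<close>, \<open>K'\<close> and the inverse \<open>J\<close> are existentially quantified because conditional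
  distribution functions are unique only up to null sets and inverses only up to flat pieces. No
  single convention on flat pieces would do: \<open>K x1\<close> may be constant (with value 1, say) on part of
  the common range for some \<open>x1\<close> and not for others, and then composing it with its own
  left-continuous or right-continuous inverse need not be increasing in \<open>x1\<close>.\<close>

definition SI_le :: "(real \<Rightarrow> real \<Rightarrow> real) \<Rightarrow> (real \<Rightarrow> real \<Rightarrow> real) \<Rightarrow> bool" where
  "SI_le H H' \<longleftrightarrow>
     bivariate_cdf H \<and> bivariate_cdf H' \<and> same_margins H H' \<and>
     (\<exists>K K' J. conditional_cdf H K \<and> conditional_cdf H' K' \<and>
        (\<forall>x1. is_inverse (K' x1) (J x1)) \<and>
        (\<forall>x2. mono (\<lambda>x1. J x1 (K x1 x2))))"

definition concordance_ordered :: "(real \<Rightarrow> real \<Rightarrow> real \<Rightarrow> real) \<Rightarrow> bool" where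
  "concordance_ordered C \<longleftrightarrow>
     (\<forall>\<theta>\<in>{-1..1}. \<forall>\<theta>'\<in>{-1..1}. \<theta> \<le> \<theta>' \<longrightarrow> concordance_le (C \<theta>) (C \<theta>'))"

definition SI_ordered :: "(real \<Rightarrow> real \<Rightarrow> real \<Rightarrow> real) \<Rightarrow> bool" where
  "SI_ordered C \<longleftrightarrow>
     (\<forall>\<theta>\<in>{-1..1}. \<forall>\<theta>'\<in>{-1..1}. \<theta> \<le> \<theta>' \<longrightarrow> SI_le (C \<theta>) (C \<theta>'))"

text \<open>A distribution function on the unit square with uniform margins, extended to the distribution
  function on the plane of the same pair of random variables.\<close>

definition unit_clip :: "real \<Rightarrow> real" where
  "unit_clip x = max 0 (min 1 x)"

definition extend_copula :: "(real \<Rightarrow> real \<Rightarrow> real) \<Rightarrow> real \<Rightarrow> real \<Rightarrow> real" where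
  "extend_copula C x y = C (unit_clip x) (unit_clip y)"

definition phi_copula :: "(real \<Rightarrow> real) \<Rightarrow> real \<Rightarrow> real \<Rightarrow> real \<Rightarrow> real" where
  "phi_copula \<phi> \<theta> u v = u * v + \<theta> * \<phi> u * \<phi> v"

text \<open>Derivatives at the end points of the interval are one-sided.\<close>

definition twice_differentiable_on :: "(real \<Rightarrow> real) \<Rightarrow> real set \<Rightarrow> bool" where
  "twice_differentiable_on f S \<longleftrightarrow>
     (\<exists>f' f''. \<forall>x\<in>S. (f has_real_derivative f' x) (at x within S) \<and>
                    (f' has_real_derivative f'' x) (at x within S))"

end

(* The second part reduces to concave phi, since phi and -phi give the same copulas; then phi >= 0
   and a = phi' is decreasing. The conditional distribution functions are y + theta * a * phi y, so
   the transport map sends v to a solution w of w + theta' * a * phi w = v + theta * a * phi v. For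
   a > 0 the right-hand side is at most the left-hand side at w = v, so the least solution is at most
   v; for a <= 0 the greatest solution is at least v. In both cases a * (theta' * phi w - theta * phi v) =
   v - w gives theta' * phi w - theta * phi v >= 0, so increasing a can only lower the solution. *)
theory Submission imports Defs begin

section \<open>Derivatives of convex functions\<close>

text \<open>Along the segment from \<open>x\<close> to \<open>y\<close>, convexity bounds every
  difference quotient at \<open>x\<close> by \<open>f y - f x\<close>, and the quotients tend to
  \<open>d * (y - x)\<close>. The derivative is taken within \<open>A\<close>, so the end points of
  an interval are covered.\<close>

lemma convex_on_above_tangent:
  fixes f :: "real \<Rightarrow> real"
  assumes f: "convex_on A f" and x: "x \<in> A" and y: "y \<in> A"
    and d: "(f has_real_derivative d) (at x within A)"
  shows "d * (y - x) \<le> f y - f x"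
proof -
  define h where "h s = x + s * (y - x)" for s
  have h: "h s = (1 - s) *\<^sub>R x + s *\<^sub>R y" for s
    by (simp add: h_def algebra_simps)
  have sub: "h ` {0..1} \<subseteq> A"
    using convexD_alt[OF convex_on_imp_convex[OF f] x y] by (auto simp: h)
  have "(f has_real_derivative d) (at (h 0) within h ` {0..1})"
    using has_field_derivative_subset[OF d sub] by (simp add: h_def)
  moreover have "(h has_real_derivative y - x) (at 0 within {0..1})"
    unfolding h_def by (auto intro!: derivative_eq_intros)
  ultimately have "((f \<circ> h) has_real_derivative d * (y - x)) (at 0 within {0..1})"
    by (rule DERIV_image_chain)
  then have "((\<lambda>s. (f (h s) - f x) / s) \<longlongrightarrow> d * (y - x)) (at 0 within {0..1})"
    by (simp add: has_field_derivative_iff h_def)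
  then show ?thesis
  proof (rule tendsto_upperbound)
    have "f (h s) - f x \<le> s * (f y - f x)" if "s \<in> {0..1}" for s
      using convex_onD[OF f, of s x y] that x y by (auto simp: h algebra_simps)
    then have "(f (h s) - f x) / s \<le> f y - f x" if "s \<in> {0..1}" "s \<noteq> 0" for s
      using that by (simp add: pos_divide_le_eq mult.commute)
    then show "\<forall>\<^sub>F s in at 0 within {0..1}. (f (h s) - f x) / s \<le> f y - f x"
      by (auto simp: eventually_at_filter intro!: always_eventually)
    show "at (0::real) within {0..1} \<noteq> bot"
      by (simp add: trivial_limit_within islimpt_Icc)
  qed
qed

text \<open>Add the tangent inequalities at \<open>x\<close> and at \<open>y\<close> and cancel
  \<open>y - x\<close>. The case \<open>x = y\<close> has to be split off: if \<open>A\<close> is a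
  single point, the derivative within \<open>A\<close> is arbitrary.\<close>

lemma convex_on_deriv_mono:
  fixes f :: "real \<Rightarrow> real"
  assumes "convex_on A f" "x \<in> A" "y \<in> A" "x \<le> y"
    and "(f has_real_derivative d) (at x within A)"
    and "(f has_real_derivative e) (at y within A)"
  shows "x = y \<or> d \<le> e"
proof -
  have "d * (y - x) \<le> f y - f x" "e * (x - y) \<le> f x - f y"
    using assms convex_on_above_tangent by blast+
  then have "d * (y - x) \<le> e * (y - x)"
    by (simp add: algebra_simps)
  then show ?thesis
    using \<open>x \<le> y\<close> by (auto simp: mult_le_cancel_right)
qed

lemma lipschitz_deriv_bound:
  fixes f :: "real \<Rightarrow> real"
  assumes "\<forall>x\<in>A. \<forall>y\<in>A. \<bar>f x - f y\<bar> \<le> \<bar>x - y\<bar>" "x \<in> A" "at x within A \<noteq> bot"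
    and d: "(f has_real_derivative d) (at x within A)"
  shows "\<bar>d\<bar> \<le> 1"
proof -
  have "((\<lambda>y. \<bar>(f y - f x) / (y - x)\<bar>) \<longlongrightarrow> \<bar>d\<bar>) (at x within A)"
    using d by (intro tendsto_rabs) (simp add: has_field_derivative_iff)
  then show ?thesis
  proof (rule tendsto_upperbound)
    show "\<forall>\<^sub>F y in at x within A. \<bar>(f y - f x) / (y - x)\<bar> \<le> 1"
      using assms(1,2) by (auto simp: eventually_at_filter pos_divide_le_eq intro!: always_eventually)
  qed fact
qed

section \<open>Extreme solutions of an equation\<close>

text \<open>The point \<open>w\<close> is the minimum of the compact set where \<open>F\<close> is
  at least \<open>t\<close>; the intermediate value theorem on \<open>{a..w}\<close> gives a
  solution in that set, which must be \<open>w\<close> itself. Minimality among all \<open>z\<close>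
  with \<open>t \<le> F z\<close>, not just among solutions, is what later turns an inequality at a
  point into a bound on \<open>w\<close>.\<close>

lemma least_solution:
  fixes F :: "real \<Rightarrow> real"
  assumes F: "continuous_on {a..b} F" and "a \<le> b" "F a \<le> t" "t \<le> F b"
  shows "\<exists>w\<in>{a..b}. F w = t \<and> (\<forall>z\<in>{a..b}. t \<le> F z \<longrightarrow> w \<le> z)"
proof -
  define S where "S = {a..b} \<inter> F -` {t..}"
  have "compact S"
    unfolding S_def using continuous_closed_preimage[OF F, of "{t..}"]
    by (auto simp: compact_eq_bounded_closed intro: bounded_subset[of "{a..b}"])
  moreover have "b \<in> S"
    using assms by (auto simp: S_def)
  ultimately obtain w where w: "w \<in> S" "\<And>z. z \<in> S \<Longrightarrow> w \<le> z"
    using compact_attains_inf[of S] by blast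
  have "continuous_on {a..w} F"
    using continuous_on_subset[OF F] w by (auto simp: S_def)
  then obtain x where x: "a \<le> x" "x \<le> w" "F x = t"
    using IVT'[of F a t w] assms w by (auto simp: S_def)
  then have "x \<in> S"
    using w by (auto simp: S_def)
  then have "x = w"
    using w x by force
  then show ?thesis
    using w x by (intro bexI[of _ w]) (auto simp: S_def)
qed

lemma greatest_solution:
  fixes F :: "real \<Rightarrow> real"
  assumes F: "continuous_on {a..b} F" and "a \<le> b" "F a \<le> t" "t \<le> F b"
  shows "\<exists>w\<in>{a..b}. F w = t \<and> (\<forall>z\<in>{a..b}. F z \<le> t \<longrightarrow> z \<le> w)"
proof -
  \<comment> \<open>The point reflection sending \<open>F\<close> to
    \<open>\<lambda>x. - F (- x)\<close> exchanges least and greatest solutions.\<close>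
  have "continuous_on {-b..-a} (\<lambda>x. - F (- x))"
    by (intro continuous_intros continuous_on_compose2[OF F]) auto
  from least_solution[OF this, of "-t"] obtain w where
    w: "w \<in> {-b..-a}" "F (- w) = t" "\<And>z. z \<in> {-b..-a} \<Longrightarrow> F (- z) \<le> t \<Longrightarrow> w \<le> z"
    using assms by auto
  have "z \<le> - w" if "z \<in> {a..b}" "F z \<le> t" for z
    using w(3)[of "- z"] that by auto
  then show ?thesis
    using w by (intro bexI[of _ "- w"]) auto
qed

section \<open>The copulas as distribution functions on the plane\<close>

lemma unit_clip_range [simp]: "0 \<le> unit_clip x" "unit_clip x \<le> 1"
  by (auto simp: unit_clip_def)

lemma unit_clip_id [simp]: "0 \<le> x \<Longrightarrow> x \<le> 1 \<Longrightarrow> unit_clip x = x"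
  by (auto simp: unit_clip_def)

lemma unit_clip_nonpos: "x \<le> 0 \<Longrightarrow> unit_clip x = 0"
  and unit_clip_ge_1: "1 \<le> x \<Longrightarrow> unit_clip x = 1"
  by (auto simp: unit_clip_def)

lemma unit_clip_mono: "x \<le> y \<Longrightarrow> unit_clip x \<le> unit_clip y"
  by (auto simp: unit_clip_def)

lemma continuous_on_unit_clip [continuous_intros]: "continuous_on S unit_clip"
  unfolding unit_clip_def by (intro continuous_intros)

section \<open>The uniform law, common to all margins\<close>

definition uniform_law :: "real measure" where
  "uniform_law = uniform_measure lborel {0..1}"

lemma real_distribution_uniform_law: "real_distribution uniform_law"
proof -
  have "prob_space uniform_law"
    unfolding uniform_law_def by (rule prob_space_uniform_measure) auto
  then show ?thesis
    by (simp add: real_distribution_def real_distribution_axioms_def uniform_law_def)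
qed

lemma Icc_Int_Iic: "{0..1} \<inter> {..x} = (if 0 \<le> x then {0..unit_clip x} else {})"
  by (auto simp: unit_clip_def)

lemma cdf_uniform_law: "cdf uniform_law = unit_clip"
proof
  fix x
  show "cdf uniform_law x = unit_clip x"
    unfolding cdf_def uniform_law_def
    by (subst measure_uniform_measure) (auto simp: Icc_Int_Iic unit_clip_nonpos simp del: Int_atLeastAtMostL1)
qed

lemma set_integral_uniform_law:
  fixes g :: "real \<Rightarrow> real"
  assumes "g \<in> borel_measurable borel"
  shows "(LINT s:{..x}|uniform_law. g s) = (LINT s:{0..1} \<inter> {..x}|lborel. g s)"
proof -
  have eq: "uniform_law = density lborel (\<lambda>s. ennreal (indicator {0..1} s))"
    unfolding uniform_law_def uniform_measure_def
    by (rule arg_cong[where f = "density lborel"]) (auto simp: fun_eq_iff divide_ennreal_def split: split_indicator)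
  show ?thesis
    unfolding set_lebesgue_integral_def eq using assms
    by (subst integral_density) (auto simp: indicator_inter_arith mult.assoc simp del: Int_atLeastAtMostL1)
qed

text \<open>These hypotheses are stable under negation; the locale is instantiated with both
  \<open>\<phi>\<close> and \<open>- \<phi>\<close> to pass from concave to convex
  functions.\<close>

locale lipschitz_bridge =
  fixes \<phi> :: "real \<Rightarrow> real"
  assumes phi_0 [simp]: "\<phi> 0 = 0" and phi_1 [simp]: "\<phi> 1 = 0"
    and lipschitz: "\<forall>x\<in>{0..1}. \<forall>y\<in>{0..1}. \<bar>\<phi> x - \<phi> y\<bar> \<le> \<bar>x - y\<bar>"
begin

lemma continuous_on_phi: "continuous_on {0..1} \<phi>"
proof (rule lipschitz_on_continuous_on)
  show "1-lipschitz_on {0..1} \<phi>"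
    using lipschitz by (intro lipschitz_onI) (auto simp: dist_real_def)
qed

lemma continuous_on_phi_clip [continuous_intros]:
  "continuous_on S f \<Longrightarrow> continuous_on S (\<lambda>x. \<phi> (unit_clip (f x)))"
  by (intro continuous_on_compose2[OF continuous_on_phi] continuous_on_compose2[OF continuous_on_unit_clip[of UNIV]]) auto

abbreviation H :: "real \<Rightarrow> real \<Rightarrow> real \<Rightarrow> real" where
  "H \<theta> \<equiv> extend_copula (phi_copula \<phi> \<theta>)"

lemma H_eq: "H \<theta> x y = unit_clip x * unit_clip y + \<theta> * \<phi> (unit_clip x) * \<phi> (unit_clip y)"
  by (simp add: extend_copula_def phi_copula_def)

lemma bivariate_cdf_H:
  assumes "\<theta> \<in> {-1..1}"
  shows "bivariate_cdf (H \<theta>)"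
  unfolding bivariate_cdf_def
proof (intro conjI allI impI)
  fix x x' y y' :: real
  assume "x \<le> x'" "y \<le> y'"
  \<comment> \<open>The mass of the rectangle is \<open>a * b + \<theta> * (c * d)\<close>. The
    Lipschitz condition bounds the increments of \<open>\<phi>\<close> by those of the clipped
    coordinates, so the second term cannot outweigh the first.\<close>
  define a b c d where "a = unit_clip x' - unit_clip x" and "b = unit_clip y' - unit_clip y"
    and "c = \<phi> (unit_clip x') - \<phi> (unit_clip x)" and "d = \<phi> (unit_clip y') - \<phi> (unit_clip y)"
  have "\<bar>c\<bar> \<le> a" "\<bar>d\<bar> \<le> b"
    using lipschitz[rule_format, of "unit_clip x'" "unit_clip x"]
      lipschitz[rule_format, of "unit_clip y'" "unit_clip y"]
      unit_clip_mono[OF \<open>x \<le> x'\<close>] unit_clip_mono[OF \<open>y \<le> y'\<close>]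
    by (auto simp: a_def b_def c_def d_def)
  then have "\<bar>\<theta>\<bar> * (\<bar>c\<bar> * \<bar>d\<bar>) \<le> 1 * (a * b)"
    using assms by (intro mult_mono) auto
  then have "0 \<le> a * b + \<theta> * (c * d)"
    by (simp add: abs_mult[symmetric])
  then show "0 \<le> H \<theta> x' y' - H \<theta> x' y - H \<theta> x y' + H \<theta> x y"
    by (simp add: H_eq a_def b_def c_def d_def algebra_simps)
next
  fix x y :: real
  have "continuous_on UNIV (\<lambda>(s, t). H \<theta> s t)"
    unfolding H_eq case_prod_unfold
    by (intro continuous_intros continuous_on_compose2[OF continuous_on_unit_clip[of UNIV]]) auto
  then have "((\<lambda>(s, t). H \<theta> s t) \<longlongrightarrow> (\<lambda>(s, t). H \<theta> s t) (x, y)) (at (x, y))"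
    by (simp add: continuous_on_def)
  then show "((\<lambda>(s, t). H \<theta> s t) \<longlongrightarrow> H \<theta> x y) (at (x, y) within {x..} \<times> {y..})"
    by (auto intro: tendsto_within_subset)
next
  fix y
  show "((\<lambda>x. H \<theta> x y) \<longlongrightarrow> 0) at_bot"
    by (rule tendsto_eventually, rule eventually_mono[OF eventually_le_at_bot[of 0]])
       (simp add: H_eq unit_clip_nonpos)
next
  fix x
  show "((\<lambda>y. H \<theta> x y) \<longlongrightarrow> 0) at_bot"
    by (rule tendsto_eventually, rule eventually_mono[OF eventually_le_at_bot[of 0]])
       (simp add: H_eq unit_clip_nonpos)
next
  show "((\<lambda>(x, y). H \<theta> x y) \<longlongrightarrow> 1) (at_top \<times>\<^sub>F at_top)"
    by (rule tendsto_eventually, rule eventually_mono[OF eventually_prodI[OF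
          eventually_ge_at_top[of "1::real"] eventually_ge_at_top[of "1::real"]]])
       (auto simp: H_eq unit_clip_ge_1)
qed

lemma margin1_H: "margin1 (H \<theta>) = unit_clip"
proof
  fix x
  have "((\<lambda>y. H \<theta> x y) \<longlongrightarrow> unit_clip x) at_top"
    by (rule tendsto_eventually, rule eventually_mono[OF eventually_ge_at_top[of 1]])
       (simp add: H_eq unit_clip_ge_1)
  then show "margin1 (H \<theta>) x = unit_clip x"
    unfolding margin1_def by (intro tendsto_Lim) auto
qed

lemma margin2_H: "margin2 (H \<theta>) = unit_clip"
proof
  fix y
  have "((\<lambda>x. H \<theta> x y) \<longlongrightarrow> unit_clip y) at_top"
    by (rule tendsto_eventually, rule eventually_mono[OF eventually_ge_at_top[of 1]])
       (simp add: H_eq unit_clip_ge_1)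
  then show "margin2 (H \<theta>) y = unit_clip y"
    unfolding margin2_def by (intro tendsto_Lim) auto
qed

lemma same_margins_H: "same_margins (H \<theta>) (H \<theta>')"
  by (simp add: same_margins_def margin1_H margin2_H)

text \<open>At clipped arguments u and v, \<open>H \<theta>'\<close> and \<open>H \<theta>\<close>
  differ by \<open>(\<theta>' - \<theta>) * \<phi> u * \<phi> v\<close>. Hence the order says that
  all products \<open>\<phi> u * \<phi> v\<close> are nonnegative, that is, that
  \<open>\<phi>\<close> does not change sign; comparing the parameters 0 and 1 already shows
  this.\<close>

lemma concordance_ordered_H:
  "concordance_ordered H \<longleftrightarrow> (\<forall>u\<in>{0..1}. \<phi> u \<ge> 0) \<or> (\<forall>u\<in>{0..1}. \<phi> u \<le> 0)"
proof
  assume H: "concordance_ordered H"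
  have "0 \<le> \<phi> u * \<phi> v" if "u \<in> {0..1}" "v \<in> {0..1}" for u v
  proof -
    have "H 0 u v \<le> H 1 u v"
      using H[unfolded concordance_ordered_def, rule_format, of 0 1] by (simp add: concordance_le_def)
    then show ?thesis
      using that by (simp add: H_eq)
  qed
  then show "(\<forall>u\<in>{0..1}. \<phi> u \<ge> 0) \<or> (\<forall>u\<in>{0..1}. \<phi> u \<le> 0)"
    by (smt (verit) mult_neg_pos)
next
  assume sign: "(\<forall>u\<in>{0..1}. \<phi> u \<ge> 0) \<or> (\<forall>u\<in>{0..1}. \<phi> u \<le> 0)"
  have "H \<theta> x y \<le> H \<theta>' x y" if "\<theta> \<le> \<theta>'" for \<theta> \<theta>' x y
  proof -
    have "0 \<le> \<phi> (unit_clip x) * \<phi> (unit_clip y)"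
      using sign by (auto intro: mult_nonneg_nonneg mult_nonpos_nonpos)
    then show ?thesis
      using mult_right_mono[OF that] by (auto simp: H_eq mult.assoc)
  qed
  then show "concordance_ordered H"
    using bivariate_cdf_H same_margins_H by (auto simp: concordance_ordered_def concordance_le_def)
qed

section \<open>Conditional distribution functions\<close>

text \<open>For \<open>c = \<theta> * a s\<close>, with \<open>a\<close> the derivative of
  \<open>\<phi>\<close> and \<open>s\<close> in the unit interval, this is the partial derivative of
  \<open>H \<theta>\<close> in its first argument at \<open>s\<close>, hence the conditional
  distribution function given \<open>s\<close>. Only the slope \<open>c\<close> depends on
  \<open>s\<close>.\<close>

definition G :: "real \<Rightarrow> real \<Rightarrow> real" where
  "G c y = unit_clip y + c * \<phi> (unit_clip y)"

lemma G_0 [simp]: "G c 0 = 0" and G_1 [simp]: "G c 1 = 1"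
  by (simp_all add: G_def)

lemma G_nonpos: "y \<le> 0 \<Longrightarrow> G c y = 0" and G_ge_1: "1 \<le> y \<Longrightarrow> G c y = 1"
  by (simp_all add: G_def unit_clip_nonpos unit_clip_ge_1)

lemma G_clip: "G c (unit_clip y) = G c y"
  by (simp add: G_def)

lemma continuous_on_G: "continuous_on S (G c)"
  unfolding G_def by (intro continuous_intros)

lemma G_mono:
  assumes "\<bar>c\<bar> \<le> 1" "x \<le> y"
  shows "G c x \<le> G c y"
proof -
  have "\<bar>c\<bar> * \<bar>\<phi> (unit_clip x) - \<phi> (unit_clip y)\<bar> \<le> 1 * \<bar>unit_clip x - unit_clip y\<bar>"
    using assms lipschitz by (intro mult_mono) auto
  then have "\<bar>c * (\<phi> (unit_clip x) - \<phi> (unit_clip y))\<bar> \<le> unit_clip y - unit_clip x"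
    using unit_clip_mono[OF \<open>x \<le> y\<close>] by (simp add: abs_mult)
  then show ?thesis
    by (simp add: G_def algebra_simps)
qed

lemma G_range: "\<bar>c\<bar> \<le> 1 \<Longrightarrow> G c y \<in> {0..1}"
  using G_mono[of c 0 "unit_clip y"] G_mono[of c "unit_clip y" 1] by (simp add: G_clip)

lemma G_is_cdf:
  assumes "\<bar>c\<bar> \<le> 1"
  shows "\<exists>\<nu>. real_distribution \<nu> \<and> G c = cdf \<nu>"
proof -
  have cont: "continuous (at_right a) (G c)" for a
    using continuous_on_G[of UNIV c] by (simp add: continuous_on_eq_continuous_at continuous_at_imp_continuous_at_within)
  have bot: "(G c \<longlongrightarrow> 0) at_bot"
    by (rule tendsto_eventually, rule eventually_mono[OF eventually_le_at_bot[of 0]]) (rule G_nonpos)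
  have top: "(G c \<longlongrightarrow> 1) at_top"
    by (rule tendsto_eventually, rule eventually_mono[OF eventually_ge_at_top[of 1]]) (rule G_ge_1)
  show ?thesis
    using real_distribution_interval_measure[OF G_mono[OF assms] cont bot top]
      cdf_interval_measure[OF G_mono[OF assms] cont bot] by metis
qed

text \<open>Integrating the partial derivative in the first argument recovers
  \<open>H \<theta>\<close>, since \<open>H \<theta> 0 y = 0\<close>. Clipping \<open>s\<close>
  extends the conditional distributions to the whole line, as a version must be a distribution
  function everywhere; the added points have measure zero under the uniform law.\<close>

lemma conditional_cdf_H:
  assumes deriv: "\<And>u. u \<in> {0..1} \<Longrightarrow> (\<phi> has_real_derivative a u) (at u within {0..1})"
    and bound: "\<And>s. \<bar>a (unit_clip s)\<bar> \<le> 1"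
    and meas: "(\<lambda>s. a (unit_clip s)) \<in> borel_measurable borel"
    and \<theta>: "\<bar>\<theta>\<bar> \<le> 1"
  shows "conditional_cdf (H \<theta>) (\<lambda>s. G (\<theta> * a (unit_clip s)))"
proof -
  have c: "\<bar>\<theta> * a (unit_clip s)\<bar> \<le> 1" for s
    using mult_mono[OF \<theta> bound[of s]] by (simp add: abs_mult)
  have meas': "(\<lambda>s. G (\<theta> * a (unit_clip s)) y) \<in> borel_measurable borel" for y
    unfolding G_def using meas by measurable
  have "H \<theta> x y = (LINT s:{..x}|uniform_law. G (\<theta> * a (unit_clip s)) y)"
    (is "_ = (LINT s:_|_. ?k s)") for x y
  proof (cases "0 \<le> x")
    case False
    then show ?thesis
      unfolding set_integral_uniform_law[OF meas'] Icc_Int_Iic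
      by (simp add: H_eq unit_clip_nonpos set_lebesgue_integral_def)
  next
    case True
    \<comment> \<open>Measurability and the bound 1 give Lebesgue integrability. The Lebesgue
      integral then equals the gauge integral, to which the fundamental theorem of calculus
      applies.\<close>
    have "set_integrable lborel {0..unit_clip x} ?k"
    proof (rule set_integrable_bound)
      show "set_integrable lborel {0..unit_clip x} (\<lambda>_. 1 :: real)"
        by (simp add: set_integrable_def)
      show "set_borel_measurable lborel {0..unit_clip x} ?k"
        using meas'[of y] by (simp add: set_borel_measurable_def)
      show "AE s in lborel. s \<in> {0..unit_clip x} \<longrightarrow> norm (?k s) \<le> norm (1 :: real)"
        using G_range[OF c] by auto
    qed
    then have "(LINT s:{..x}|uniform_law. ?k s) = integral {0..unit_clip x} ?k"
      using True by (simp add: set_integral_uniform_law[OF meas'] Icc_Int_Iic set_borel_integral_eq_integral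
          del: Int_atLeastAtMostL1)
    also have "\<dots> = H \<theta> x y - H \<theta> 0 y"
    proof (rule integral_unique)
      let ?h = "\<lambda>s. s * unit_clip y + \<theta> * \<phi> s * \<phi> (unit_clip y)"
      have "(?h has_real_derivative ?k s) (at s within {0..unit_clip x})" if "s \<in> {0..unit_clip x}" for s
      proof -
        have s: "s \<in> {0..1}"
          using that by (auto intro: order_trans[OF _ unit_clip_range(2)])
        have "(\<phi> has_real_derivative a s) (at s within {0..unit_clip x})"
          using has_field_derivative_subset[OF deriv[OF s]] by auto
        then show ?thesis
          using s by (auto intro!: derivative_eq_intros simp: G_def)
      qed
      then have "(?k has_integral ?h (unit_clip x) - ?h 0) {0..unit_clip x}"
        by (intro fundamental_theorem_of_calculus)
           (auto simp: has_real_derivative_iff_has_vector_derivative)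
      then show "(?k has_integral H \<theta> x y - H \<theta> 0 y) {0..unit_clip x}"
        by (simp add: H_eq)
    qed
    finally show ?thesis
      by (simp add: H_eq)
  qed
  moreover have "cdf uniform_law = margin1 (H \<theta>)"
    by (simp add: cdf_uniform_law margin1_H)
  ultimately show ?thesis
    unfolding conditional_cdf_def using G_is_cdf[OF c] meas' real_distribution_uniform_law by blast
qed

section \<open>The SI order\<close>

text \<open>On flat pieces of \<open>G c\<close> the choice of point that keeps the transport maps monotone depends
  on the sign of the conditional slope \<open>a\<close>.\<close>

definition solution :: "real \<Rightarrow> real \<Rightarrow> real \<Rightarrow> real \<Rightarrow> bool" where
  "solution a c t w \<longleftrightarrow> w \<in> {0..1} \<and> G c w = t \<and>
     (0 < a \<longrightarrow> (\<forall>z\<in>{0..1}. t \<le> G c z \<longrightarrow> w \<le> z)) \<and>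
     (a \<le> 0 \<longrightarrow> (\<forall>z\<in>{0..1}. G c z \<le> t \<longrightarrow> z \<le> w))"

lemma solution_exists:
  assumes "t \<in> {0..1}"
  shows "\<exists>w. solution a c t w"
proof (cases "0 < a")
  case True
  obtain w where "w \<in> {0..1}" "G c w = t" "\<forall>z\<in>{0..1}. t \<le> G c z \<longrightarrow> w \<le> z"
    using least_solution[OF continuous_on_G, of 0 1 c t] assms by auto
  then have "solution a c t w"
    using True by (simp add: solution_def)
  then show ?thesis ..
next
  case False
  obtain w where "w \<in> {0..1}" "G c w = t" "\<forall>z\<in>{0..1}. G c z \<le> t \<longrightarrow> z \<le> w"
    using greatest_solution[OF continuous_on_G, of 0 1 c t] assms by auto
  then have "solution a c t w"
    using False by (simp add: solution_def)
  then show ?thesis ..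
qed

text \<open>As \<open>G c\<close> is weakly increasing, a point where it takes the value
  \<open>t\<close> separates values at most \<open>t\<close> from values at least
  \<open>t\<close>.\<close>

lemma is_inverse_solution:
  assumes c: "\<bar>c\<bar> \<le> 1" and J: "\<And>t. t \<in> {0..1} \<Longrightarrow> solution a c t (J t)"
  shows "is_inverse (G c) (\<lambda>t. ereal (J t))"
  unfolding is_inverse_def
proof (intro ballI allI conjI impI)
  fix t z :: real
  assume t: "t \<in> {0..1}"
  have "G c (J t) = t"
    using J[OF t] by (simp add: solution_def)
  then show "G c z \<le> t" if "ereal z < ereal (J t)"
    using G_mono[OF c, of z "J t"] that by simp
  show "t \<le> G c z" if "ereal (J t) < ereal z"
    using G_mono[OF c, of "J t" z] \<open>G c (J t) = t\<close> that by simp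
qed

text \<open>At \<open>v\<close>, replacing \<open>\<theta>\<close> by \<open>\<theta>'\<close>
  changes the conditional distribution function by
  \<open>a * (\<theta>' - \<theta>) * \<phi> v\<close>, which is nonnegative for positive
  \<open>a\<close> and nonpositive otherwise. The extremality of \<open>w\<close> turns this into a
  comparison with \<open>v\<close>; an arbitrary solution on a flat piece could lie on the wrong
  side.\<close>

lemma solution_vs_level:
  assumes pos: "\<forall>u\<in>{0..1}. \<phi> u \<ge> 0" and le: "\<theta> \<le> \<theta>'" and v: "v \<in> {0..1}"
    and w: "solution a (\<theta>' * a) (G (\<theta> * a) v) w"
  shows "0 < a \<Longrightarrow> w \<le> v" and "a \<le> 0 \<Longrightarrow> v \<le> w"
proof -
  have diff: "G (\<theta>' * a) v - G (\<theta> * a) v = a * ((\<theta>' - \<theta>) * \<phi> v)"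
    using v by (simp add: G_def algebra_simps)
  have nn: "0 \<le> (\<theta>' - \<theta>) * \<phi> v"
    using pos le v by simp
  show "w \<le> v" if "0 < a"
  proof -
    have "G (\<theta> * a) v \<le> G (\<theta>' * a) v"
      using diff mult_nonneg_nonneg[OF less_imp_le[OF that] nn] by simp
    then show ?thesis
      using w v that by (auto simp: solution_def)
  qed
  show "v \<le> w" if "a \<le> 0"
  proof -
    have "G (\<theta>' * a) v \<le> G (\<theta> * a) v"
      using diff mult_nonpos_nonneg[OF that nn] by simp
    then show ?thesis
      using w v that by (auto simp: solution_def)
  qed
qed

lemma solution_antimono:
  assumes pos: "\<forall>u\<in>{0..1}. \<phi> u \<ge> 0" and le: "\<theta> \<le> \<theta>'" and v: "v \<in> {0..1}"
    and w1: "solution a1 (\<theta>' * a1) (G (\<theta> * a1) v) w1"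
    and w2: "solution a2 (\<theta>' * a2) (G (\<theta> * a2) v) w2"
    and a: "a1 < a2"
  shows "w2 \<le> w1"
proof -
  \<comment> \<open>\<open>D w\<close> is the coefficient of the slope \<open>b\<close> in the
    defect \<open>G (\<theta>' * b) w - G (\<theta> * b) v\<close>. Where \<open>D\<close> is
    nonnegative, a larger slope gives a larger defect.\<close>
  define D where "D w = \<theta>' * \<phi> w - \<theta> * \<phi> v" for w
  have G_diff: "G (\<theta>' * b) w - G (\<theta> * b) v = w - v + b * D w" if "w \<in> {0..1}" for b w
    using that v by (simp add: G_def D_def algebra_simps)
  have r: "w1 \<in> {0..1}" "w2 \<in> {0..1}"
    using w1 w2 by (auto simp: solution_def)
  have eq: "a1 * D w1 = v - w1" "a2 * D w2 = v - w2"
    using w1 w2 G_diff[OF r(1), of a1] G_diff[OF r(2), of a2] by (auto simp: solution_def)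
  note cmp1 = solution_vs_level[OF pos le v w1] and cmp2 = solution_vs_level[OF pos le v w2]
  consider "0 < a1" | "a1 \<le> 0" "0 < a2" | "a2 \<le> 0"
    by linarith
  then show ?thesis
  proof cases
    \<comment> \<open>Here \<open>w1 \<le> v\<close> forces \<open>0 \<le> D w1\<close>. Raising the
      slope to \<open>a2\<close> makes the defect at \<open>w1\<close> nonnegative, so the least
      solution \<open>w2\<close> is at most \<open>w1\<close>.\<close>
    case 1
    then have "0 \<le> a1 * D w1"
      using eq cmp1 by simp
    then have "0 \<le> D w1"
      using 1 by (simp add: zero_le_mult_iff)
    then have "a1 * D w1 \<le> a2 * D w1"
      using a by (intro mult_right_mono) auto
    then have "G (\<theta> * a2) v \<le> G (\<theta>' * a2) w1"
      using eq G_diff[OF r(1), of a2] by linarith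
    then show ?thesis
      using w2 r 1 a by (auto simp: solution_def)
  next
    \<comment> \<open>The value \<open>v\<close> separates the two solutions:
      \<open>w2 \<le> v \<le> w1\<close>.\<close>
    case 2
    then show ?thesis
      using cmp1 cmp2 by linarith
  next
    \<comment> \<open>Dual to the first case: start from \<open>w2\<close>, where lowering the slope
      to \<open>a1\<close> makes the defect nonpositive, so the greatest solution \<open>w1\<close>
      is at least \<open>w2\<close>.\<close>
    case 3
    have "a1 * D w2 \<le> a2 * D w2"
    \<comment> \<open>With slope zero the sign of \<open>D w2\<close> cannot be read off from
      \<open>a2 * D w2\<close>. But then \<open>w2 = v\<close>, and
      \<open>D v = (\<theta>' - \<theta>) * \<phi> v\<close> is nonnegative.\<close>
    proof (cases "a2 = 0")
      case True
      then have "w2 = v"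
        using eq by simp
      then have "0 \<le> D w2"
        using le pos v by (auto simp: D_def intro: mult_right_mono)
      then show ?thesis
        using a by (intro mult_right_mono) auto
    next
      case False
      have "a2 * D w2 \<le> 0"
        using eq cmp2 3 by simp
      then have "0 \<le> D w2"
        using 3 False by (simp add: mult_le_0_iff)
      then show ?thesis
        using a by (intro mult_right_mono) auto
    qed
    then have "G (\<theta>' * a1) w2 \<le> G (\<theta> * a1) v"
      using eq G_diff[OF r(2), of a1] by linarith
    then show ?thesis
      using w1 r 3 a by (auto simp: solution_def)
  qed
qed

lemma SI_ordered_H_concave:
  assumes conc: "concave_on {0..1} \<phi>"
    and deriv: "\<And>u. u \<in> {0..1} \<Longrightarrow> (\<phi> has_real_derivative d u) (at u within {0..1})"
  shows "SI_ordered H"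
proof -
  define a where "a s = d (unit_clip s)" for s
  have pos: "\<forall>u\<in>{0..1}. \<phi> u \<ge> 0"
  proof
    fix u :: real
    assume "u \<in> {0..1}"
    \<comment> \<open>A concave function lies above its chord, and the chord between the zeros at 0
      and 1 is the axis.\<close>
    then show "0 \<le> \<phi> u"
      using concave_onD[OF conc, of u 0 1] by simp
  qed
  have anti: "a y \<le> a x" if "x \<le> y" for x y
  proof -
    have "((\<lambda>u. - \<phi> u) has_real_derivative - d u) (at u within {0..1})" if "u \<in> {0..1}" for u
      using deriv[OF that] by (rule DERIV_minus)
    from convex_on_deriv_mono[OF conc[unfolded concave_on_def] _ _ unit_clip_mono[OF that] this this]
    show ?thesis
      by (auto simp: a_def)
  qed
  \<comment> \<open>Measurability of the derivative comes from its monotonicity.\<close>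
  then have "(\<lambda>s. - a s) \<in> borel_measurable borel"
    by (intro borel_measurable_mono) (auto simp: mono_def)
  then have meas: "a \<in> borel_measurable borel"
    by simp
  have bound: "\<bar>a s\<bar> \<le> 1" for s
    unfolding a_def
    by (rule lipschitz_deriv_bound[OF lipschitz _ _ deriv]) (auto simp: trivial_limit_within islimpt_Icc)
  have c: "\<bar>\<theta> * a s\<bar> \<le> 1" if "\<bar>\<theta>\<bar> \<le> 1" for \<theta> s
    using mult_mono[OF that bound[of s]] by (simp add: abs_mult)
  have "SI_le (H \<theta>) (H \<theta>')" if \<theta>: "\<theta> \<in> {-1..1}" "\<theta>' \<in> {-1..1}" "\<theta> \<le> \<theta>'" for \<theta> \<theta>'
  proof -
    have abs: "\<bar>\<theta>\<bar> \<le> 1" "\<bar>\<theta>'\<bar> \<le> 1"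
      using \<theta> by auto
    \<comment> \<open>The inverse is indexed by the slope \<open>b\<close> instead of the
      conditioning point, so two points with the same slope share the same transport map. This
      settles the case \<open>a x = a x'\<close>, leaving strictly different slopes for
      \<open>solution_antimono\<close>.\<close>
    define J where "J b t = (SOME w. solution b (\<theta>' * b) t w)" for b t
    have J: "solution b (\<theta>' * b) t (J b t)" if "t \<in> {0..1}" for b t
      unfolding J_def by (rule someI_ex[OF solution_exists[OF that]])
    have "J (a x) (G (\<theta> * a x) y) \<le> J (a x') (G (\<theta> * a x') y)" if "x \<le> x'" for x x' y
    proof (cases "a x = a x'")
      case False
      \<comment> \<open>The level is rewritten as the value at \<open>unit_clip y\<close>, since the
        comparison of solutions requires \<open>v\<close> in the unit interval.\<close>
      have "solution (a s) (\<theta>' * a s) (G (\<theta> * a s) (unit_clip y)) (J (a s) (G (\<theta> * a s) y))" for s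
        using J[OF G_range[OF c[OF abs(1)]]] by (simp add: G_clip)
      from solution_antimono[OF pos \<theta>(3) _ this this] show ?thesis
        using False anti[OF that] by simp
    qed simp
    then have "mono (\<lambda>x. ereal (J (a x) (G (\<theta> * a x) y)))" for y
      by (auto simp: mono_def)
    moreover have "is_inverse (G (\<theta>' * a x)) (\<lambda>t. ereal (J (a x) t))" for x
      by (rule is_inverse_solution[OF c[OF abs(2)] J])
    moreover have "conditional_cdf (H \<eta>) (\<lambda>x. G (\<eta> * a x))" if "\<bar>\<eta>\<bar> \<le> 1" for \<eta>
      using conditional_cdf_H[OF deriv] bound meas that unfolding a_def by auto
    ultimately have "conditional_cdf (H \<theta>) (\<lambda>x. G (\<theta> * a x)) \<and> conditional_cdf (H \<theta>') (\<lambda>x. G (\<theta>' * a x)) \<and>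
        (\<forall>x. is_inverse (G (\<theta>' * a x)) (\<lambda>t. ereal (J (a x) t))) \<and>
        (\<forall>y. mono (\<lambda>x. ereal (J (a x) (G (\<theta> * a x) y))))"
      using abs by blast
    then have "\<exists>K K' L. conditional_cdf (H \<theta>) K \<and> conditional_cdf (H \<theta>') K' \<and>
        (\<forall>x. is_inverse (K' x) (L x)) \<and> (\<forall>y. mono (\<lambda>x. L x (K x y)))"
      by (intro exI[of _ "\<lambda>x. G (\<theta> * a x)"] exI[of _ "\<lambda>x. G (\<theta>' * a x)"]
          exI[of _ "\<lambda>x t. ereal (J (a x) t)"])
    then show ?thesis
      unfolding SI_le_def using \<theta> by (intro conjI bivariate_cdf_H same_margins_H)
  qed
  then show ?thesis
    by (simp add: SI_ordered_def)
qed

end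

section \<open>Both order claims, with the convex case obtained by negation\<close>

theorem theorem4:
  fixes \<phi> :: "real \<Rightarrow> real"
  assumes "\<phi> 0 = 0" and "\<phi> 1 = 0"
    and "\<forall>x\<in>{0..1}. \<forall>y\<in>{0..1}. \<bar>\<phi> x - \<phi> y\<bar> \<le> \<bar>x - y\<bar>"
  shows "(concordance_ordered (\<lambda>\<theta>. extend_copula (phi_copula \<phi> \<theta>)) \<longleftrightarrow>
            (\<forall>u\<in>{0..1}. \<phi> u \<ge> 0) \<or> (\<forall>u\<in>{0..1}. \<phi> u \<le> 0)) \<and>
         (twice_differentiable_on \<phi> {0..1} \<longrightarrow>
            convex_on {0..1} \<phi> \<or> concave_on {0..1} \<phi> \<longrightarrow>
            SI_ordered (\<lambda>\<theta>. extend_copula (phi_copula \<phi> \<theta>)))"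
proof (intro conjI impI)
  interpret lipschitz_bridge \<phi>
    using assms by unfold_locales
  show "concordance_ordered H \<longleftrightarrow> (\<forall>u\<in>{0..1}. \<phi> u \<ge> 0) \<or> (\<forall>u\<in>{0..1}. \<phi> u \<le> 0)"
    by (rule concordance_ordered_H)
  assume "twice_differentiable_on \<phi> {0..1}"
  then obtain d where d: "\<And>u. u \<in> {0..1} \<Longrightarrow> (\<phi> has_real_derivative d u) (at u within {0..1})"
    unfolding twice_differentiable_on_def by blast
  assume "convex_on {0..1} \<phi> \<or> concave_on {0..1} \<phi>"
  then show "SI_ordered H"
  proof
    assume "convex_on {0..1} \<phi>"
    interpret neg: lipschitz_bridge "\<lambda>u. - \<phi> u"
    proof
      show "\<forall>x\<in>{0..1}. \<forall>y\<in>{0..1}. \<bar>- \<phi> x - - \<phi> y\<bar> \<le> \<bar>x - y\<bar>"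
        using lipschitz by (simp add: abs_minus_commute)
    qed simp_all
    have "SI_ordered neg.H"
    proof (rule neg.SI_ordered_H_concave)
      show "concave_on {0..1} (\<lambda>u. - \<phi> u)"
        using \<open>convex_on {0..1} \<phi>\<close> by (simp add: concave_on_def)
    qed (rule DERIV_minus[OF d])
    moreover have "phi_copula (\<lambda>u. - \<phi> u) = phi_copula \<phi>"
      by (simp add: phi_copula_def fun_eq_iff)
    ultimately show ?thesis
      by simp
  next
    assume "concave_on {0..1} \<phi>"
    then show ?thesis
      using d by (rule SI_ordered_H_concave)
  qed
qed

end
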